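(* Let $k,q\in\mathbb{N}$ and $p>0$, and put $$R_5=R^{k,p,q}=\sqrt[qk]{\frac{\min\{p,2\}}{2+\min\{p,2\}}}.$$ Let $f\in\mathcal{B}$ with $a=|f(0)|<1$ have the form $f(z)=\sum_{j=0}^\infty a_{qj}z^{qj}$, and let $\omega_k\in\mathcal{B}_k$. Then $$D_f(z):=a^p+\sum_{j=1}^\infty|a_{qj}|\,|\omega_k(z)|^{qj}+\Big(\frac1{1+a}+\frac{|\omega_k(z)|^q}{1-|\omega_k(z)|^q}\Big)\sum_{j=1}^\infty|a_{qj}|^2|\omega_k(z)|^{2qj}\le1$$ for $|z|=r\le R_5$. The result is sharp: for every $R\in(R_5,1)$ there exist such $f$ and $\omega_k$ and a point $z$ with $|z|\le R$ such that $D_f(z)>1$.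
   Context: $\mathbb{N}=\{1,2,\dots\}$ and $\mathbb{D}=\{z\in\mathbb{C}:|z|<1\}$. $\mathcal{B}$ is the class of analytic functions $f$ on $\mathbb{D}$ with $\sup_{z\in\mathbb{D}}|f(z)|\le 1$. For $k\in\mathbb{N}$, $\mathcal{B}_k=\{\omega\in\mathcal{B}:\omega(0)=\cdots=\omega^{(k-1)}(0)=0,\ \omega^{(k)}(0)\ne0\}$. *)

theory Defs
  imports "HOL-Complex_Analysis.Complex_Analysis"
begin

definition class_B :: "(complex \<Rightarrow> complex) set" where
  "class_B = {f. f holomorphic_on ball 0 1 \<and> (\<forall>z\<in>ball 0 1. norm (f z) \<le> 1)}"

definition class_Bk :: "nat \<Rightarrow> (complex \<Rightarrow> complex) set" where
  "class_Bk k = {\<omega> \<in> class_B. (\<forall>n<k. (deriv ^^ n) \<omega> 0 = 0) \<and> (deriv ^^ k) \<omega> 0 \<noteq> 0}"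

text \<open>Only the values of \<open>a\<close> at multiples of \<open>q\<close> matter.\<close>

definition has_q_expansion :: "nat \<Rightarrow> (nat \<Rightarrow> complex) \<Rightarrow> (complex \<Rightarrow> complex) \<Rightarrow> bool" where
  "has_q_expansion q a f \<longleftrightarrow> (\<forall>z\<in>ball 0 1. (\<lambda>j. a (q * j) * z ^ (q * j)) sums f z)"

definition R5 :: "nat \<Rightarrow> real \<Rightarrow> nat \<Rightarrow> real" where
  "R5 k p q = root (q * k) (min p 2 / (2 + min p 2))"

text \<open>The sums over \<open>j \<ge> 1\<close> are indexed by \<open>Suc j\<close>.\<close>

definition D_f :: "real \<Rightarrow> nat \<Rightarrow> (nat \<Rightarrow> complex) \<Rightarrow> (complex \<Rightarrow> complex) \<Rightarrow> (complex \<Rightarrow> complex)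
    \<Rightarrow> complex \<Rightarrow> real" where
  "D_f p q a f \<omega> z =
     norm (f 0) powr p
     + (\<Sum>j. norm (a (q * Suc j)) * norm (\<omega> z) ^ (q * Suc j))
     + (1 / (1 + norm (f 0)) + norm (\<omega> z) ^ q / (1 - norm (\<omega> z) ^ q))
       * (\<Sum>j. (norm (a (q * Suc j)))\<^sup>2 * norm (\<omega> z) ^ (2 * q * Suc j))"

text \<open>The following lemmas show that no junk value enters: \<open>R5\<close> lies in the open unit
  interval, functions in \<open>class_Bk k\<close> map the disk into itself, and both series converge.\<close>

lemma R5_bounds:
  assumes "k \<ge> 1" "q \<ge> 1" "p > 0"
  shows "0 < R5 k p q" "R5 k p q < 1"
  using assms unfolding R5_def by (auto simp: min_def field_simps)

lemma class_Bk_norm_less_1: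
  assumes \<omega>: "\<omega> \<in> class_Bk k" and k: "k \<ge> 1" and z: "norm z < 1"
  shows "norm (\<omega> z) < 1"
proof (rule ccontr)
  assume neg: "\<not> norm (\<omega> z) < 1"
  have hol: "\<omega> holomorphic_on ball 0 1" and le: "\<And>w. w \<in> ball 0 1 \<Longrightarrow> norm (\<omega> w) \<le> 1"
    using \<omega> by (auto simp: class_Bk_def class_B_def)
  have "(deriv ^^ 0) \<omega> 0 = 0" using \<omega> k by (fastforce simp: class_Bk_def)
  hence 0: "\<omega> 0 = 0" by simp
  have "\<omega> constant_on ball 0 1"
    by (rule maximum_modulus_principle[OF hol, of "ball 0 1" z])
       (use z neg le in \<open>auto simp: not_less intro: order_trans\<close>)
  then have "\<omega> z = \<omega> 0" using z by (force simp: constant_on_def)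
  with 0 neg show False by simp
qed

lemma D_f_summable:
  assumes f: "has_q_expansion q a f" and q: "q \<ge> 1" and x: "0 \<le> x" "x < 1"
  shows "summable (\<lambda>j. norm (a (q * Suc j)) * x ^ (q * Suc j))" (is ?A)
    and "summable (\<lambda>j. (norm (a (q * Suc j)))\<^sup>2 * x ^ (2 * q * Suc j))" (is ?B)
proof -
  define y where "y = (1 + x) / 2"
  have y: "x < y" "y < 1" "0 < y" using x by (auto simp: y_def)
  have "(\<lambda>j. a (q * j) * of_real y ^ (q * j)) sums f (of_real y)"
    using f y by (auto simp: has_q_expansion_def)
  hence "summable (\<lambda>j. a (q * j) * (of_real y ^ q) ^ j)"
    by (simp add: power_mult sums_iff)
  moreover have "norm (of_real x ^ q :: complex) < norm (of_real y ^ q :: complex)"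
    using x y q by (simp add: norm_power power_strict_mono)
  ultimately have "summable (\<lambda>j. norm (a (q * j) * (of_real x ^ q) ^ j))"
    by (rule powser_insidea)
  hence "summable (\<lambda>j. norm (a (q * j)) * x ^ (q * j))"
    using x by (simp add: norm_mult norm_power power_mult)
  from summable_ignore_initial_segment[OF this, of 1] show A: ?A by simp
  let ?t = "\<lambda>j. norm (a (q * Suc j)) * x ^ (q * Suc j)"
  have "\<forall>\<^sub>F j in sequentially. ?t j < 1"
    using summable_LIMSEQ_zero[OF A] by (rule order_tendstoD(2)) simp
  then have "\<forall>\<^sub>F j in sequentially. norm ((?t j)\<^sup>2) \<le> ?t j"
  proof eventually_elim
    case (elim j)
    have "0 \<le> ?t j" using x by simp
    then have "(?t j)\<^sup>2 \<le> ?t j"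
      using elim power_decreasing[of 1 2 "?t j"] by simp
    then show ?case by (metis norm_power power2_abs real_norm_def)
  qed
  then have "summable (\<lambda>j. (?t j)\<^sup>2)"
    using A by (rule summable_comparison_test_ev)
  moreover have "(?t j)\<^sup>2 = (norm (a (q * Suc j)))\<^sup>2 * x ^ (2 * q * Suc j)" for j
    by (simp add: power_mult_distrib flip: power_mult) (simp add: algebra_simps)
  ultimately show ?B by simp
qed

end

(* With b_j = a_{qj} the function g(w) = sum_j b_j w^j is bounded by 1 on the disk, because
   f(z) = g(z^q).  Bessel-type duality on circles shows that the lower triangular Toeplitz matrix
   of (b_j) is a contraction; testing it on suitable vectors gives Carlson's inequalities
     |b_N| + sum_{2i<N} |b_i|^2 + [N = 2i] |b_i|^2 / (1 + |b_0|) <= 1.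
   Multiplying by x^N, where x = |omega(z)|^q, and summing over N >= 1 bounds D_f(z) by
   a^p + (1 - a^2) x / (1 - x).  Schwarz's lemma gives x <= |z|^(qk), and a convexity estimate
   finishes the upper bound.  For f(z) = (z^q - a) / (1 - a z^q) and omega(z) = z^k equality holds
   in the bound for D_f, so sharpness reduces to a real inequality: for p > 2 take a = 0, otherwise
   let a be close to 1. *)

theory Submission
  imports Defs
begin

section \<open>Toeplitz contraction\<close>

text \<open>The characters of the circle, with period 1 so that integrals over \<open>{0..1}\<close>
  need no normalising factor; integer frequencies turn conjugation into negation.\<close>

definition unit_char :: "int \<Rightarrow> real \<Rightarrow> complex" where
  "unit_char n t = cis (2 * pi * of_int n * t)"

lemma norm_unit_char [simp]: "norm (unit_char n t) = 1"
  by (simp add: unit_char_def)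

lemma cnj_unit_char [simp]: "cnj (unit_char n t) = unit_char (- n) t"
  by (simp add: unit_char_def cis_cnj)

lemma unit_char_mult: "unit_char m t * unit_char n t = unit_char (m + n) t"
  by (simp add: unit_char_def cis_mult algebra_simps)

lemma unit_char_power: "unit_char n t ^ k = unit_char (int k * n) t"
  by (simp add: unit_char_def Complex.DeMoivre algebra_simps)

lemma continuous_on_unit_char: "continuous_on A (unit_char n)"
  unfolding unit_char_def by (intro continuous_intros)

lemma has_integral_unit_char:
  "(unit_char n has_integral (if n = 0 then 1 else 0)) {0..1}"
proof (cases "n = 0")
  case True
  have "((\<lambda>t::real. 1::complex) has_integral 1) {0..1}"
    using has_integral_const_real[of "1::complex" 0 1] by simp
  then show ?thesis using True by (simp add: unit_char_def[abs_def] cong: has_integral_cong)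
next
  case False
  define F where "F t = unit_char n t / (2 * pi * of_int n * \<i>)" for t
  have "(F has_vector_derivative unit_char n t) (at t within {0..1})" for t
    unfolding F_def unit_char_def cis_conv_exp using False
    by (auto intro!: derivative_eq_intros has_vector_derivative_real_field simp: field_simps)
  then have "(unit_char n has_integral (F 1 - F 0)) {0..1}"
    by (intro fundamental_theorem_of_calculus) auto
  moreover have "F 1 = F 0"
    by (simp add: F_def unit_char_def cis_multiple_2pi)
  ultimately show ?thesis using False by simp
qed

text \<open>Fourier coefficients of \<open>g\<close> on the circle of radius \<open>r\<close>: its
  frequency \<open>k\<close> component is \<open>b k * r ^ k\<close>, and it has no negative
  frequencies. Uniform convergence on this circle permits termwise integration.\<close>

lemma has_integral_powser_unit_char:
  assumes sums: "\<And>w. norm w < 1 \<Longrightarrow> (\<lambda>n. b n * w ^ n) sums g w"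
    and r: "0 \<le> r" "r < 1"
  shows "((\<lambda>t. g (of_real r * unit_char 1 t) * unit_char m t) has_integral
           (if m \<le> 0 then b (nat (- m)) * of_real r ^ nat (- m) else 0)) {0..1}"
proof -
  define h where "h k t = b k * of_real r ^ k * unit_char (int k + m) t" for k t
  have h_eq: "h k t = b k * (of_real r * unit_char 1 t) ^ k * unit_char m t" for k t
    by (simp add: h_def power_mult_distrib unit_char_power mult.assoc flip: unit_char_mult)
  have nr: "norm (of_real r * unit_char 1 t) < 1" for t
    using r by (simp add: norm_mult)
  have h_sums: "(\<lambda>k. h k t) sums (g (of_real r * unit_char 1 t) * unit_char m t)" for t
    unfolding h_eq by (intro sums_mult2 sums nr)
  have M: "summable (\<lambda>k. norm (b k * of_real r ^ k))"
  proof (rule powser_insidea)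
    \<comment> \<open>Convergence at a point strictly between \<open>r\<close> and 1 gives absolute
      convergence at \<open>r\<close>, hence the Weierstrass majorant.\<close>
    show "summable (\<lambda>k. b k * of_real ((1 + r) / 2) ^ k)"
      by (rule sums_summable, rule sums) (use r in \<open>auto simp del: of_real_divide of_real_add\<close>)
  qed (use r in \<open>auto simp del: of_real_divide of_real_add\<close>)
  have "uniform_limit (cbox 0 1) (\<lambda>K t. \<Sum>k<K. h k t) (\<lambda>t. \<Sum>k. h k t) sequentially"
    by (rule Weierstrass_m_test[OF _ M]) (simp add: h_def norm_mult)
  moreover have "continuous_on (cbox 0 1) (\<lambda>t. \<Sum>k<K. h k t)" for K
    unfolding h_def by (intro continuous_intros continuous_on_unit_char)
  ultimately obtain I J where
    I: "\<And>K. ((\<lambda>t. \<Sum>k<K. h k t) has_integral I K) (cbox 0 1)"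
    and J: "((\<lambda>t. \<Sum>k. h k t) has_integral J) (cbox 0 1)" and lim: "I \<longlonglongrightarrow> J"
    by (rule uniform_limit_integral_cbox) auto
  define c where "c = (if m \<le> 0 then b (nat (- m)) * of_real r ^ nat (- m) else 0)"
  have "I K = c" if K: "K > nat (- m)" for K
  proof -
    have "((\<lambda>t. \<Sum>k<K. h k t) has_integral
            (\<Sum>k<K. b k * of_real r ^ k * (if int k + m = 0 then 1 else 0))) (cbox 0 1)"
      unfolding h_def
      by (intro has_integral_sum finite_lessThan has_integral_mult_right)
         (use has_integral_unit_char in auto)
    with I have "I K = (\<Sum>k<K. b k * of_real r ^ k * (if int k + m = 0 then 1 else 0))"
      by (rule has_integral_unique)
    \<comment> \<open>For \<open>m > 0\<close> no frequency cancels; \<open>nat (- m)\<close> is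
      then 0, but \<open>c\<close> is 0 as well, so the formula still holds.\<close>
    also have "\<dots> = (\<Sum>k<K. if k = nat (- m) then c else 0)"
      by (intro sum.cong) (auto simp: c_def)
    also have "\<dots> = c" using K by simp
    finally show ?thesis .
  qed
  then have "\<forall>\<^sub>F K in sequentially. I K = c"
    by (rule eventually_mono[OF eventually_gt_at_top])
  then have "I \<longlonglongrightarrow> c" by (rule tendsto_eventually)
  with lim have "J = c" by (rule LIMSEQ_unique)
  with J h_sums show ?thesis by (simp add: sums_iff c_def)
qed

text \<open>Parseval for trigonometric polynomials: orthogonality leaves only the diagonal of the
  double sum.\<close>

lemma has_integral_trig_norm_sq:
  "((\<lambda>t. (norm (\<Sum>i\<le>N. u i * unit_char (int i) t))\<^sup>2) has_integral (\<Sum>i\<le>N. (norm (u i))\<^sup>2)) {0..1}"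
proof -
  have eq: "(\<Sum>i\<le>N. u i * unit_char (int i) t) * cnj (\<Sum>i\<le>N. u i * unit_char (int i) t)
        = (\<Sum>i\<le>N. \<Sum>j\<le>N. u i * cnj (u j) * unit_char (int i - int j) t)" for t
    by (simp add: sum_product unit_char_mult[symmetric] mult_ac
          flip: add_uminus_conv_diff)
  have "((\<lambda>t. \<Sum>i\<le>N. \<Sum>j\<le>N. u i * cnj (u j) * unit_char (int i - int j) t) has_integral
     (\<Sum>i\<le>N. \<Sum>j\<le>N. u i * cnj (u j) * (if int i - int j = 0 then 1 else 0))) {0..1}"
    by (intro has_integral_sum has_integral_mult_right has_integral_unit_char finite_atMost)
  also have "(\<Sum>i\<le>N. \<Sum>j\<le>N. u i * cnj (u j) * (if int i - int j = 0 then 1 else 0))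
      = (\<Sum>i\<le>N. u i * cnj (u i))"
    by (simp add: if_distrib cong: if_cong)
  finally have "((\<lambda>t. complex_of_real ((norm (\<Sum>i\<le>N. u i * unit_char (int i) t))\<^sup>2)) has_integral
     of_real (\<Sum>i\<le>N. (norm (u i))\<^sup>2)) {0..1}"
    by (simp only: eq[symmetric] complex_norm_square of_real_sum)
  from has_integral_Re[OF this] show ?thesis by simp
qed

text \<open>The contraction property in the form 2 Re <Tu, v> \<le> |u|^2 + |v|^2. The left side is
  the integral of \<open>2 * Re (cnj (V t) * (G t * U t))\<close>; pointwise, |G| \<le> 1 and
  2|U||V| \<le> |U|^2 + |V|^2, and Parseval evaluates the right side. Boundary values of
  \<open>g\<close> are avoided by staying at a radius \<open>r < 1\<close>.\<close>

lemma toeplitz_form_bound_circle: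
  assumes sums: "\<And>w. norm w < 1 \<Longrightarrow> (\<lambda>n. b n * w ^ n) sums g w"
    and bound: "\<And>w. norm w < 1 \<Longrightarrow> norm (g w) \<le> 1"
    and r: "0 \<le> r" "r < 1"
  shows "2 * Re (\<Sum>i\<le>N. cnj (v i) * (\<Sum>j\<le>i. b (i - j) * of_real r ^ (i - j) * u j))
           \<le> (\<Sum>i\<le>N. (norm (u i))\<^sup>2) + (\<Sum>i\<le>N. (norm (v i))\<^sup>2)"
proof -
  define U where "U t = (\<Sum>i\<le>N. u i * unit_char (int i) t)" for t
  define V where "V t = (\<Sum>i\<le>N. v i * unit_char (int i) t)" for t
  define G where "G t = g (of_real r * unit_char 1 t)" for t
  have eq: "cnj (V t) * (G t * U t) =
      (\<Sum>i\<le>N. \<Sum>j\<le>N. cnj (v i) * u j * (G t * unit_char (int j - int i) t))" for t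
    by (subst sum.swap) (simp add: U_def V_def sum_product sum_distrib_left
          unit_char_mult[symmetric] mult_ac flip: add_uminus_conv_diff)
  have "((\<lambda>t. cnj (V t) * (G t * U t)) has_integral
     (\<Sum>i\<le>N. \<Sum>j\<le>N. cnj (v i) * u j *
        (if int j - int i \<le> 0 then b (nat (- (int j - int i))) * of_real r ^ nat (- (int j - int i)) else 0))) {0..1}"
    unfolding eq unfolding G_def
    by (intro has_integral_sum has_integral_mult_right has_integral_powser_unit_char
          sums r finite_atMost)
  \<comment> \<open>The entries with \<open>j > i\<close> vanish since \<open>G\<close> has no
    negative frequencies; this makes the matrix lower triangular.\<close>
  also have "(\<Sum>i\<le>N. \<Sum>j\<le>N. cnj (v i) * u j *
        (if int j - int i \<le> 0 then b (nat (- (int j - int i))) * of_real r ^ nat (- (int j - int i)) else 0))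
      = (\<Sum>i\<le>N. cnj (v i) * (\<Sum>j\<le>i. b (i - j) * of_real r ^ (i - j) * u j))"
  proof (intro sum.cong refl)
    fix i assume "i \<in> {..N}"
    then have "(\<Sum>j\<le>i. cnj (v i) * (b (i - j) * of_real r ^ (i - j) * u j)) =
      (\<Sum>j\<le>N. cnj (v i) * u j *
        (if int j - int i \<le> 0 then b (nat (- (int j - int i))) * of_real r ^ nat (- (int j - int i)) else 0))"
      by (intro sum.mono_neutral_cong_left) (auto simp: nat_diff_distrib)
    then show "(\<Sum>j\<le>N. cnj (v i) * u j *
        (if int j - int i \<le> 0 then b (nat (- (int j - int i))) * of_real r ^ nat (- (int j - int i)) else 0))
        = cnj (v i) * (\<Sum>j\<le>i. b (i - j) * of_real r ^ (i - j) * u j)"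
      by (simp add: sum_distrib_left)
  qed
  finally have I: "((\<lambda>t. 2 * Re (cnj (V t) * (G t * U t))) has_integral
      2 * Re (\<Sum>i\<le>N. cnj (v i) * (\<Sum>j\<le>i. b (i - j) * of_real r ^ (i - j) * u j))) {0..1}"
    by (intro has_integral_mult_right has_integral_Re)
  have J: "((\<lambda>t. (norm (U t))\<^sup>2 + (norm (V t))\<^sup>2) has_integral
      (\<Sum>i\<le>N. (norm (u i))\<^sup>2) + (\<Sum>i\<le>N. (norm (v i))\<^sup>2)) {0..1}"
    unfolding U_def V_def by (intro has_integral_add has_integral_trig_norm_sq)
  show ?thesis
  proof (rule has_integral_le[OF I J])
    fix t
    have "norm (G t) \<le> 1"
      unfolding G_def by (rule bound) (use r in \<open>simp add: norm_mult\<close>)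
    then have "norm (G t) * norm (U t) \<le> norm (U t)"
      by (simp add: mult_left_le_one_le)
    then have "norm (V t) * (norm (G t) * norm (U t)) \<le> norm (V t) * norm (U t)"
      by (simp add: mult_left_mono)
    moreover have "Re (cnj (V t) * (G t * U t)) \<le> norm (V t) * (norm (G t) * norm (U t))"
      using complex_Re_le_cmod[of "cnj (V t) * (G t * U t)"] by (simp add: norm_mult)
    moreover have "2 * (norm (V t) * norm (U t)) \<le> (norm (U t))\<^sup>2 + (norm (V t))\<^sup>2"
      using sum_squares_bound[of "norm (V t)" "norm (U t)"] by simp
    ultimately show "2 * Re (cnj (V t) * (G t * U t)) \<le> (norm (U t))\<^sup>2 + (norm (V t))\<^sup>2"
      by linarith
  qed
qed

text \<open>The form is a polynomial in \<open>r\<close> and the bound is independent of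
  \<open>r\<close>, so \<open>r\<close> may tend to 1 from the left.\<close>

lemma toeplitz_form_bound:
  assumes sums: "\<And>w. norm w < 1 \<Longrightarrow> (\<lambda>n. b n * w ^ n) sums g w"
    and bound: "\<And>w. norm w < 1 \<Longrightarrow> norm (g w) \<le> 1"
  shows "2 * Re (\<Sum>i\<le>N. cnj (v i) * (\<Sum>j\<le>i. b (i - j) * u j))
           \<le> (\<Sum>i\<le>N. (norm (u i))\<^sup>2) + (\<Sum>i\<le>N. (norm (v i))\<^sup>2)"
proof (rule tendsto_upperbound)
  show "((\<lambda>r. 2 * Re (\<Sum>i\<le>N. cnj (v i) * (\<Sum>j\<le>i. b (i - j) * of_real r ^ (i - j) * u j)))
      \<longlongrightarrow> 2 * Re (\<Sum>i\<le>N. cnj (v i) * (\<Sum>j\<le>i. b (i - j) * u j))) (at_left 1)"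
    by (auto intro!: tendsto_eq_intros)
  have "\<forall>\<^sub>F r::real in at_left 1. r \<in> {0<..<1}"
    by (intro eventually_at_leftI[of 0]) auto
  then show "\<forall>\<^sub>F r in at_left 1.
      2 * Re (\<Sum>i\<le>N. cnj (v i) * (\<Sum>j\<le>i. b (i - j) * of_real r ^ (i - j) * u j))
        \<le> (\<Sum>i\<le>N. (norm (u i))\<^sup>2) + (\<Sum>i\<le>N. (norm (v i))\<^sup>2)"
    by eventually_elim (use toeplitz_form_bound_circle[OF sums bound] in auto)
qed simp

section \<open>Carlson's inequalities and the refined Bohr inequality\<close>

text \<open>The zero weight beyond \<open>N / 2\<close> lets all sums run over
  \<open>i \<le> N\<close>, which makes the reversal of indices harmless.\<close>

definition carlson_weight :: "real \<Rightarrow> nat \<Rightarrow> nat \<Rightarrow> real" where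
  "carlson_weight a N i = (if 2 * i < N then 1 else if 2 * i = N then 1 / (1 + a) else 0)"

text \<open>With the vectors \<open>u\<close> and \<open>v\<close> below, the real part of the
  Toeplitz form is at least |b_N| + 2P minus a middle term, while both squared norms are 1 + Q. The
  weights are chosen so that the difference collapses to P.\<close>

lemma carlson_inequality:
  fixes b :: "nat \<Rightarrow> complex" and g :: "complex \<Rightarrow> complex"
  assumes sums: "\<And>w. norm w < 1 \<Longrightarrow> (\<lambda>n. b n * w ^ n) sums g w"
    and bound: "\<And>w. norm w < 1 \<Longrightarrow> norm (g w) \<le> 1"
    and N: "N \<ge> 1"
  shows "norm (b N) + (\<Sum>i\<le>N. carlson_weight (norm (b 0)) N i * (norm (b i))\<^sup>2) \<le> 1"
proof -
  define a where "a = norm (b 0)"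
  define \<sigma> where "\<sigma> = carlson_weight a N"
  define \<rho> where "\<rho> = 1 / (1 + a)"
  have a: "a \<ge> 0" by (simp add: a_def)
  obtain t where t: "norm t = 1" "cnj t * b N = of_real (norm (b N))"
  proof (cases "b N = 0")
    case True
    then show ?thesis by (intro that[of 1]) auto
  next
    case False
    have "cnj (sgn (b N)) * b N = (b N * cnj (b N)) / of_real (norm (b N))"
      by (simp add: sgn_eq)
    also have "\<dots> = of_real (norm (b N))"
      using False by (simp add: power2_eq_square flip: complex_norm_square)
    finally have "cnj (sgn (b N)) * b N = of_real (norm (b N))" .
    with False show ?thesis by (intro that[of "sgn (b N)"]) (auto simp: norm_sgn)
  qed
  have tt: "cnj t * t = 1"
    using t(1) complex_norm_square[of t] by (simp add: mult.commute)
  have \<sigma>0: "\<sigma> i = 0" if "2 * i > N" for i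
    using that by (simp add: \<sigma>_def carlson_weight_def)
  have \<sigma>N: "\<sigma> N = 0" using N by (simp add: \<sigma>0)
  \<comment> \<open>The column 0 and row \<open>N\<close> of the Toeplitz matrix, truncated to half length so that they overlap
    only in the middle index (present for even \<open>N\<close>); the weight \<open>\<rho>\<close> there maximizes
    \<open>2 * \<rho> - (1 + a) * \<rho>\<^sup>2\<close>, and \<open>t\<close> aligns the phase of the corner entry \<open>b N\<close>.\<close>
  define u where "u j = (if j = 0 then 1 else t * of_real (\<sigma> (N - j)) * cnj (b (N - j)))" for j
  define v where "v i = (if i = N then t else of_real (\<sigma> i) * b i)" for i
  define P where "P = (\<Sum>i\<le>N. \<sigma> i * (norm (b i))\<^sup>2)"
  define Q where "Q = (\<Sum>i\<le>N. (\<sigma> i)\<^sup>2 * (norm (b i))\<^sup>2)"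
  define M where "M = (\<Sum>i\<le>N. if 2 * i = N then (norm (b i))\<^sup>2 else 0)"
  have rev: "(\<Sum>j\<le>N. h (N - j)) = (\<Sum>j\<le>N. h j)" for h :: "nat \<Rightarrow> real"
    by (rule sum.reindex_bij_witness[of _ "\<lambda>j. N - j" "\<lambda>j. N - j"]) auto
  have split_last: "(\<Sum>i\<le>N. h i) = (\<Sum>i<N. h i) + h N" for h :: "nat \<Rightarrow> 'z::comm_monoid_add"
    by (simp add: lessThan_Suc_atMost[symmetric])
  have split_0: "(\<Sum>i\<le>n. h i) = h 0 + (\<Sum>i\<in>{0<..n}. h i)" for h :: "nat \<Rightarrow> 'z::comm_monoid_add" and n
    by (simp add: atMost_atLeast0 sum.head)
  have nu: "(\<Sum>i\<le>N. (norm (u i))\<^sup>2) = 1 + Q"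
  proof -
    have "(\<Sum>i\<le>N. (norm (u i))\<^sup>2) = 1 + (\<Sum>j\<in>{0<..N}. (\<sigma> (N - j))\<^sup>2 * (norm (b (N - j)))\<^sup>2)"
      unfolding split_0 by (intro arg_cong2[of _ _ _ _ "(+)"] sum.cong)
        (auto simp: u_def norm_mult t power_mult_distrib)
    also have "(\<Sum>j\<in>{0<..N}. (\<sigma> (N - j))\<^sup>2 * (norm (b (N - j)))\<^sup>2)
        = (\<Sum>j\<le>N. (\<sigma> (N - j))\<^sup>2 * (norm (b (N - j)))\<^sup>2)"
      unfolding split_0 by (simp add: \<sigma>N)
    also have "\<dots> = Q"
      unfolding Q_def by (rule rev)
    finally show ?thesis .
  qed
  have nv: "(\<Sum>i\<le>N. (norm (v i))\<^sup>2) = 1 + Q"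
    unfolding Q_def split_last by (simp add: v_def t \<sigma>N norm_mult power_mult_distrib)
  \<comment> \<open>Where \<open>v i\<close> can be nonzero, \<open>2 * i \<le> N\<close>, whereas
    \<open>u j\<close> with \<open>j > 0\<close> needs \<open>2 * j \<ge> N\<close>. So row
    \<open>i\<close> meets \<open>u\<close> only in column 0 and, if \<open>2 * i = N\<close>, on
    the diagonal.\<close>
  have row: "cnj (v i) * (\<Sum>j\<le>i. b (i - j) * u j) = of_real (\<sigma> i * (norm (b i))\<^sup>2)
      + (if 2 * i = N then of_real (\<rho>\<^sup>2) * (b 0 * t * (cnj (b i))\<^sup>2) else 0)" if i: "i < N" for i
  proof (cases "2 * i \<le> N")
    case False
    then show ?thesis using i by (simp add: v_def \<sigma>0)
  next
    case True
    have "(\<Sum>j\<in>{0<..i}. b (i - j) * u j) = (\<Sum>j\<in>{0<..i}. if j = i then b 0 * u i else 0)"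
      using True N by (intro sum.cong) (auto simp: u_def \<sigma>0)
    also have "\<dots> = (if 2 * i = N then b 0 * (t * of_real \<rho> * cnj (b i)) else 0)"
      using True N i by (auto simp: u_def \<sigma>0 \<sigma>_def \<rho>_def carlson_weight_def)
    finally have "(\<Sum>j\<le>i. b (i - j) * u j)
        = b i + (if 2 * i = N then b 0 * (t * of_real \<rho> * cnj (b i)) else 0)"
      unfolding split_0 by (simp add: u_def)
    then have "cnj (v i) * (\<Sum>j\<le>i. b (i - j) * u j) = of_real (\<sigma> i) * (b i * cnj (b i))
      + (if 2 * i = N then of_real (\<sigma> i * \<rho>) * (b 0 * t * (cnj (b i))\<^sup>2) else 0)"
      using i by (simp add: v_def algebra_simps power2_eq_square)
    moreover have "\<sigma> i = \<rho>" if "2 * i = N"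
      using that by (simp add: \<sigma>_def carlson_weight_def \<rho>_def)
    ultimately show ?thesis
      by (simp add: complex_norm_square[symmetric] power2_eq_square[of \<rho>] flip: of_real_power)
  qed
  \<comment> \<open>Row \<open>N\<close> meets all of \<open>u\<close>; the phases cancel and a
    second copy of \<open>P\<close> appears, the first one coming from the rows above.\<close>
  have last: "cnj (v N) * (\<Sum>j\<le>N. b (N - j) * u j) = of_real (norm (b N) + P)"
  proof -
    have "cnj (v N) * (\<Sum>j\<le>N. b (N - j) * u j) = cnj t * b N +
       (\<Sum>j\<in>{0<..N}. cnj t * t * of_real (\<sigma> (N - j)) * (b (N - j) * cnj (b (N - j))))"
      unfolding split_0 by (simp add: u_def v_def distrib_left sum_distrib_left mult_ac)
    also have "\<dots> = of_real (norm (b N) + (\<Sum>j\<in>{0<..N}. \<sigma> (N - j) * (norm (b (N - j)))\<^sup>2))"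
      by (simp add: t tt complex_norm_square[symmetric])
    also have "(\<Sum>j\<in>{0<..N}. \<sigma> (N - j) * (norm (b (N - j)))\<^sup>2)
        = (\<Sum>j\<le>N. \<sigma> (N - j) * (norm (b (N - j)))\<^sup>2)"
      unfolding split_0 by (simp add: \<sigma>N)
    also have "\<dots> = P" unfolding P_def by (rule rev)
    finally show ?thesis .
  qed
  have "Re (\<Sum>i\<le>N. cnj (v i) * (\<Sum>j\<le>i. b (i - j) * u j))
      = (\<Sum>i<N. \<sigma> i * (norm (b i))\<^sup>2 + (if 2 * i = N then \<rho>\<^sup>2 * Re (b 0 * t * (cnj (b i))\<^sup>2) else 0))
        + (norm (b N) + P)"
    unfolding split_last[of "\<lambda>i. cnj (v i) * (\<Sum>j\<le>i. b (i - j) * u j)"] last Re_sum plus_complex.sel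
    by (intro arg_cong2[of _ _ _ _ "(+)"] sum.cong) (auto simp: row simp flip: of_real_power)
  \<comment> \<open>The phase of the middle cross term is unknown, so it is replaced by minus its
    modulus.\<close>
  also have "\<dots> \<ge> (\<Sum>i<N. \<sigma> i * (norm (b i))\<^sup>2 - (if 2 * i = N then \<rho>\<^sup>2 * a * (norm (b i))\<^sup>2 else 0))
        + (norm (b N) + P)"
  proof (intro add_right_mono sum_mono)
    fix i
    have "norm (b 0 * t * (cnj (b i))\<^sup>2) = a * (norm (b i))\<^sup>2"
      by (simp add: norm_mult norm_power t a_def)
    then have "- (a * (norm (b i))\<^sup>2) \<le> Re (b 0 * t * (cnj (b i))\<^sup>2)"
      using abs_Re_le_cmod[of "b 0 * t * (cnj (b i))\<^sup>2"] by linarith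
    then have "\<rho>\<^sup>2 * - (a * (norm (b i))\<^sup>2) \<le> \<rho>\<^sup>2 * Re (b 0 * t * (cnj (b i))\<^sup>2)"
      by (rule mult_left_mono) simp
    then show "\<sigma> i * (norm (b i))\<^sup>2 - (if 2 * i = N then \<rho>\<^sup>2 * a * (norm (b i))\<^sup>2 else 0) \<le>
       \<sigma> i * (norm (b i))\<^sup>2 + (if 2 * i = N then \<rho>\<^sup>2 * Re (b 0 * t * (cnj (b i))\<^sup>2) else 0)"
      by (simp add: mult.assoc)
  qed
  also have "(\<Sum>i<N. \<sigma> i * (norm (b i))\<^sup>2 - (if 2 * i = N then \<rho>\<^sup>2 * a * (norm (b i))\<^sup>2 else 0))
      = P - \<rho>\<^sup>2 * a * M"
    using N unfolding P_def M_def split_last sum_subtractf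
    by (simp add: \<sigma>N sum_distrib_left if_distrib[of "\<lambda>x. \<rho>\<^sup>2 * a * x"] cong: if_cong)
  finally have "Re (\<Sum>i\<le>N. cnj (v i) * (\<Sum>j\<le>i. b (i - j) * u j)) \<ge> 2 * P - \<rho>\<^sup>2 * a * M + norm (b N)"
    by simp
  with toeplitz_form_bound[OF sums bound, where N = N and u = u and v = v] nu nv
  have "norm (b N) + (2 * P - Q - \<rho>\<^sup>2 * a * M) \<le> 1"
    by simp
  \<comment> \<open>Termwise: weight 1 gives 2 - 1 = 1, weight 0 gives 0, and in the middle
    \<open>\<rho> * (1 + a) = 1\<close> absorbs the cross term.\<close>
  also have "2 * P - Q - \<rho>\<^sup>2 * a * M = P"
  proof -
    have "2 * \<rho> - \<rho>\<^sup>2 - \<rho>\<^sup>2 * a = \<rho>"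
    proof -
      have "\<rho> * (1 + a) = 1" using a by (simp add: \<rho>_def)
      then have "\<rho> * (\<rho> * (1 + a)) = \<rho>" by simp
      then show ?thesis by (simp add: algebra_simps power2_eq_square)
    qed
    then have *: "2 * (\<sigma> i * s) - (\<sigma> i)\<^sup>2 * s - \<rho>\<^sup>2 * a * (if 2 * i = N then s else 0) = \<sigma> i * s" for i s
      by (auto simp: \<sigma>_def carlson_weight_def \<rho>_def[symmetric] simp flip: left_diff_distrib mult.assoc)
    have "2 * P - Q - \<rho>\<^sup>2 * a * M = (\<Sum>i\<le>N. 2 * (\<sigma> i * (norm (b i))\<^sup>2) - (\<sigma> i)\<^sup>2 * (norm (b i))\<^sup>2
        - \<rho>\<^sup>2 * a * (if 2 * i = N then (norm (b i))\<^sup>2 else 0))"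
      unfolding P_def Q_def M_def sum_subtractf by (simp add: sum_distrib_left)
    then show ?thesis unfolding * P_def .
  qed
  finally show ?thesis unfolding P_def \<sigma>_def a_def .
qed

text \<open>Carlson's inequality for each \<open>n \<ge> 1\<close> is multiplied by
  \<open>x ^ n\<close> and summed. For \<open>i \<ge> 1\<close>, |b_i|^2 is collected from all
  \<open>n > 2 * i\<close>, which gives x^(2i) x/(1-x), and from \<open>n = 2 * i\<close> with
  factor 1/(1+a). The term |b_0|^2 moves to the right.\<close>

lemma refined_bohr_inequality:
  fixes b :: "nat \<Rightarrow> complex" and g :: "complex \<Rightarrow> complex"
  assumes sums: "\<And>w. norm w < 1 \<Longrightarrow> (\<lambda>n. b n * w ^ n) sums g w"
    and bound: "\<And>w. norm w < 1 \<Longrightarrow> norm (g w) \<le> 1"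
    and x: "0 \<le> x" "x < 1"
  shows "(\<Sum>j. norm (b (Suc j)) * x ^ Suc j)
           + (1 / (1 + norm (b 0)) + x / (1 - x)) * (\<Sum>j. (norm (b (Suc j)))\<^sup>2 * x ^ (2 * Suc j))
         \<le> (1 - (norm (b 0))\<^sup>2) * (x / (1 - x))"
proof -
  define a where "a = norm (b 0)"
  have a: "a \<ge> 0" by (simp add: a_def)
  \<comment> \<open>\<open>E\<close> places |b_i|^2 at position 2i and omits \<open>i = 0\<close>;
    \<open>A n\<close> then collects the indices with 0 < 2i < n and satisfies A(n+1) = A(n) +
    E(n).\<close>
  define E where "E m = (if even m \<and> m > 0 then (norm (b (m div 2)))\<^sup>2 else 0)" for m
  define A where "A n = (\<Sum>m<n. E m)" for n
  have E_nonneg: "E n \<ge> 0" for n by (simp add: E_def)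
  have A_nonneg: "A n \<ge> 0" for n by (simp add: A_def sum_nonneg E_nonneg)
  have carlson: "norm (b n) + A n + E n / (1 + a) \<le> 1 - a\<^sup>2" if n: "n \<ge> 1" for n
  proof -
    let ?h = "\<lambda>m. if even m then (if m < n then 1 else 1 / (1 + a)) * (norm (b (m div 2)))\<^sup>2 else 0"
    have "(\<Sum>i\<le>n. carlson_weight a n i * (norm (b i))\<^sup>2)
        = (\<Sum>i\<in>{i. 2 * i \<le> n}. carlson_weight a n i * (norm (b i))\<^sup>2)"
      by (intro sum.mono_neutral_right) (auto simp: carlson_weight_def)
    also have "\<dots> = (\<Sum>m\<in>{m. even m \<and> m \<le> n}. ?h m)"
      by (rule sum.reindex_bij_witness[of _ "\<lambda>m. m div 2" "\<lambda>i. 2 * i"])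
         (auto simp: carlson_weight_def)
    also have "\<dots> = (\<Sum>m\<in>{..n}. ?h m)"
      by (intro sum.mono_neutral_left) auto
    also have "\<dots> = (\<Sum>m<n. ?h m) + ?h n"
      by (simp add: lessThan_Suc_atMost[symmetric])
    also have "(\<Sum>m<n. ?h m) = (\<Sum>m<n. E m + (if m = 0 then a\<^sup>2 else 0))"
      by (intro sum.cong) (auto simp: E_def a_def)
    also have "\<dots> = A n + a\<^sup>2"
      using n by (simp add: sum.distrib A_def)
    also have "?h n = E n / (1 + a)"
      using n by (simp add: E_def)
    finally show ?thesis
      using carlson_inequality[OF sums bound n] unfolding a_def[symmetric] by simp
  qed
  \<comment> \<open>These uniform bounds on \<open>A\<close>, \<open>E\<close> and \<open>b\<close>
    make every series below comparable with the geometric one.\<close>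
  have A_le: "A n \<le> 1" for n
  proof (cases "n \<ge> 1")
    case True
    have "E n / (1 + a) \<ge> 0" using E_nonneg[of n] a by simp
    with carlson[OF True] zero_le_power2[of a] norm_ge_zero[of "b n"] show ?thesis by linarith
  qed (simp add: A_def not_le)
  have E_le: "E n \<le> 1" for n
    using A_le[of "Suc n"] A_nonneg[of n] by (simp add: A_def)
  have b_le: "norm (b (Suc n)) \<le> 1" for n
  proof -
    have "E (Suc n) / (1 + a) \<ge> 0" using E_nonneg[of "Suc n"] a by simp
    with carlson[of "Suc n"] A_nonneg[of "Suc n"] zero_le_power2[of a] show ?thesis by linarith
  qed
  have geo: "summable (\<lambda>n. x ^ n)" using x by simp
  have summable_bdd: "summable (\<lambda>n. h n * x ^ n)" if "\<And>n. 0 \<le> h n" "\<And>n. h n \<le> 1" for h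
    by (rule summable_comparison_test'[OF geo, of 0])
       (use that x in \<open>auto simp: abs_mult mult_left_le_one_le\<close>)
  define T where "T = (\<Sum>n. A n * x ^ n)"
  define W where "W = (\<Sum>n. E n * x ^ n)"
  define B where "B = (\<Sum>n. norm (b (Suc n)) * x ^ Suc n)"
  have sA: "(\<lambda>n. A n * x ^ n) sums T"
    unfolding T_def by (intro summable_sums summable_bdd A_nonneg A_le)
  have sE: "(\<lambda>n. E n * x ^ n) sums W"
    unfolding W_def by (intro summable_sums summable_bdd E_nonneg E_le)
  have sB: "(\<lambda>n. norm (b (Suc n)) * x ^ Suc n) sums B"
    unfolding B_def
    using summable_mult[OF summable_bdd[of "\<lambda>n. norm (b (Suc n))"], of x] b_le
    by (intro summable_sums) (simp add: mult_ac)
  have sA': "(\<lambda>n. A (Suc n) * x ^ Suc n) sums T"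
    using sA by (subst sums_Suc_iff) (simp add: A_def)
  have sE': "(\<lambda>n. E (Suc n) * x ^ Suc n) sums W"
    using sE by (subst sums_Suc_iff) (simp add: E_def)
  \<comment> \<open>The recurrence for \<open>A\<close> becomes \<open>T = x * (T + W)\<close> for
    the generating functions, which replaces an interchange of double sums.\<close>
  have "(\<lambda>n. x * (A n * x ^ n + E n * x ^ n)) sums (x * (T + W))"
    by (intro sums_mult sums_add sA sE)
  also have "(\<lambda>n. x * (A n * x ^ n + E n * x ^ n)) = (\<lambda>n. A (Suc n) * x ^ Suc n)"
    by (simp add: A_def algebra_simps)
  finally have "T = x * (T + W)"
    using sA' by (rule sums_unique2[symmetric])
  then have T: "T = x / (1 - x) * W"
    using x by (simp add: field_simps)
  have "(\<lambda>j. E (2 * Suc j) * x ^ (2 * Suc j)) sums W"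
  proof (subst sums_mono_reindex[of "\<lambda>j. 2 * Suc j" "\<lambda>n. E n * x ^ n"])
    show "E n * x ^ n = 0" if "n \<notin> range (\<lambda>j. 2 * Suc j)" for n
    proof -
      have "\<not> (even n \<and> n > 0)"
      proof
        assume "even n \<and> n > 0"
        then have "n = 2 * Suc (n div 2 - 1)" by auto
        with that show False by blast
      qed
      then show ?thesis by (auto simp: E_def)
    qed
  qed (use sE in \<open>auto simp: strict_mono_def\<close>)
  then have W: "(\<Sum>j. (norm (b (Suc j)))\<^sup>2 * x ^ (2 * Suc j)) = W"
    by (simp add: E_def sums_iff)
  have "B + T + W * (1 / (1 + a)) \<le> (1 - a\<^sup>2) * (x * (1 / (1 - x)))"
  proof (rule sums_le)
    show "(\<lambda>n. norm (b (Suc n)) * x ^ Suc n + A (Suc n) * x ^ Suc n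
        + E (Suc n) * x ^ Suc n * (1 / (1 + a))) sums (B + T + W * (1 / (1 + a)))"
      by (intro sums_add sums_mult2 sA' sE' sB)
    have "(\<lambda>n. (1 - a\<^sup>2) * (x * x ^ n)) sums ((1 - a\<^sup>2) * (x * (1 / (1 - x))))"
      using x by (intro sums_mult geometric_sums) auto
    then show "(\<lambda>n. (1 - a\<^sup>2) * x ^ Suc n) sums ((1 - a\<^sup>2) * (x * (1 / (1 - x))))"
      by simp
    show "norm (b (Suc n)) * x ^ Suc n + A (Suc n) * x ^ Suc n
        + E (Suc n) * x ^ Suc n * (1 / (1 + a)) \<le> (1 - a\<^sup>2) * x ^ Suc n" for n
      using mult_right_mono[OF carlson[of "Suc n"], of "x ^ Suc n"] x
      by (simp add: algebra_simps)
  qed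
  then show ?thesis
    unfolding W a_def[symmetric] B_def[symmetric] T by (simp add: algebra_simps)
qed

section \<open>Schwarz lemma of higher order and real inequalities\<close>

text \<open>Write f(z) = z^k h(z), with \<open>h\<close> given by the shifted Taylor series so that
  no singularity at 0 needs removing. As \<open>f\<close> is bounded only inside the disk, the
  maximum principle is applied on radius \<open>s < 1\<close>, giving |h| \<le> 1/s^k, and then
  \<open>s\<close> tends to 1.\<close>

lemma schwarz_higher_order:
  assumes hol: "f holomorphic_on ball 0 1"
    and bound: "\<And>z. norm z < 1 \<Longrightarrow> norm (f z) \<le> 1"
    and zero: "\<And>n. n < k \<Longrightarrow> (deriv ^^ n) f 0 = 0"
    and z: "norm z < 1"
  shows "norm (f z) \<le> norm z ^ k"
proof -
  define c where "c n = (deriv ^^ n) f 0 / fact n" for n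
  define h where "h w = (\<Sum>n. c (n + k) * w ^ n)" for w
  have c_sums: "(\<lambda>n. c n * w ^ n) sums f w" if "norm w < 1" for w
    using holomorphic_power_series[OF hol, of w] that by (simp add: c_def)
  have shifted: "(\<lambda>n. c (n + k) * w ^ (n + k)) sums f w" if "norm w < 1" for w
  proof -
    have "(\<Sum>n<k. c n * w ^ n) = 0" by (simp add: c_def zero)
    then show ?thesis
      using sums_split_initial_segment[OF c_sums[OF that], of k] by simp
  qed
  have h_sums: "(\<lambda>n. c (n + k) * w ^ n) sums h w" if w: "norm w < 1" for w
  proof (cases "w = 0")
    case True
    then show ?thesis
      using powser_sums_zero_iff[of "\<lambda>n. c (n + k)"] by (simp add: h_def)
  next
    case False
    have "(\<lambda>n. c (n + k) * w ^ (n + k) / w ^ k) sums (f w / w ^ k)"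
      by (intro sums_divide shifted w)
    then have "(\<lambda>n. c (n + k) * w ^ n) sums (f w / w ^ k)"
      using False by (simp add: power_add)
    then show ?thesis by (simp add: h_def sums_iff)
  qed
  have f_eq: "f w = h w * w ^ k" if "norm w < 1" for w
    using sums_unique2[OF shifted[OF that], of "h w * w ^ k"] sums_mult2[OF h_sums[OF that], of "w ^ k"]
    by (simp add: power_add mult.assoc)
  have hol_h: "h holomorphic_on ball 0 1"
    by (rule power_series_holomorphic) (use h_sums in auto)
  have le: "norm (h z) \<le> 1 / s ^ k" if s: "norm z < s" "s < 1" for s
  proof (rule maximum_modulus_frontier[of h "ball 0 s"])
    have s0: "s > 0" using s norm_ge_zero[of z] by linarith
    show "h holomorphic_on interior (ball 0 s)"
      using hol_h by (rule holomorphic_on_subset) (use s in auto)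
    show "continuous_on (closure (ball 0 s)) h"
      using holomorphic_on_imp_continuous_on[OF hol_h]
      by (rule continuous_on_subset) (use s s0 in auto)
    show "z \<in> ball 0 s" using s by simp
    fix w :: complex assume "w \<in> frontier (ball 0 s)"
    then have w: "norm w = s" using s0 by simp
    then have "norm (h w) * s ^ k \<le> 1"
      using bound[of w] f_eq[of w] s by (simp add: norm_mult norm_power)
    then show "norm (h w) \<le> 1 / s ^ k"
      using s0 by (simp add: field_simps)
  qed simp
  have "norm (h z) \<le> 1"
  proof (rule tendsto_lowerbound)
    show "((\<lambda>s::real. 1 / s ^ k) \<longlongrightarrow> 1) (at_left 1)"
      by (auto intro!: tendsto_eq_intros)
    show "\<forall>\<^sub>F s in at_left 1. norm (h z) \<le> 1 / s ^ k"
      using z le by (intro eventually_at_leftI[of "norm z"]) auto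
  qed simp
  then have "norm (h z) * norm z ^ k \<le> 1 * norm z ^ k"
    by (intro mult_right_mono) auto
  then show ?thesis using f_eq[OF z] by (simp add: norm_mult norm_power)
qed

text \<open>For \<open>p \<le> 2\<close>, t^(p/2) is concave in t = a^2 and lies below its tangent
  at t = 1; this is Young's inequality with second factor 1. For \<open>p > 2\<close>, a^p \<le> a^2
  suffices.\<close>

lemma powr_add_mult_le_one:
  fixes a p Y :: real
  assumes a: "0 \<le> a" "a < 1" and p: "p > 0" and Y: "Y \<le> min p 2 / 2"
  shows "a powr p + (1 - a\<^sup>2) * Y \<le> 1"
proof -
  have sq: "a\<^sup>2 \<le> 1" using a by (simp add: power_le_one)
  have "a powr p \<le> 1 - (1 - a\<^sup>2) * (min p 2 / 2)"
  proof (cases "a = 0")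
    case True
    then show ?thesis by auto
  next
    case False
    with a have a0: "a > 0" by simp
    show ?thesis
    proof (cases "p \<le> 2")
      case True
      have "(a\<^sup>2) powr (p / 2) * 1 powr (1 - p / 2) \<le> p / 2 * a\<^sup>2 + (1 - p / 2) * 1"
        by (rule Youngs_inequality_0) (use True p a0 in auto)
      moreover have "(a\<^sup>2) powr (p / 2) = a powr p"
        using a0 by (simp add: powr_powr flip: powr_numeral)
      ultimately show ?thesis using True by (simp add: algebra_simps)
    next
      case False
      then have "a powr p \<le> a powr 2" using a a0 by (intro powr_mono') auto
      then show ?thesis using False a0 by simp
    qed
  qed
  moreover have "(1 - a\<^sup>2) * Y \<le> (1 - a\<^sup>2) * (min p 2 / 2)"
    using sq Y by (intro mult_left_mono) auto
  ultimately show ?thesis by linarith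
qed

text \<open>For \<open>p \<le> 2\<close>, compare first orders at s = 1: the loss 1 - s^p is about
  p(1-s), the gain (1-s^2)X about 2X(1-s), and 2X > p. For \<open>p > 2\<close> already X > 1, so s
  = 0 works.\<close>

lemma powr_add_mult_gt_one:
  fixes p X :: real
  assumes p: "p > 0" and X: "X > min p 2 / 2"
  obtains s where "0 \<le> s" "s < 1" "s powr p + (1 - s\<^sup>2) * X > 1"
proof (cases "p \<le> 2")
  case False
  with X show ?thesis by (intro that[of 0]) auto
next
  case True
  \<comment> \<open>\<open>s\<^sup>2\<close> is the midpoint of p/(2X) and 1, so that 2 s^2 X = X +
    p/2 > p.\<close>
  define s where "s = sqrt ((1 + p / (2 * X)) / 2)"
  have X0: "X > p / 2" "X > 0" using X True p by auto
  have sq: "s\<^sup>2 = (1 + p / (2 * X)) / 2" using p X0 by (simp add: s_def)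
  have s0: "s > 0" unfolding s_def using p X0 by (simp add: add_pos_pos)
  have s1: "s < 1" unfolding s_def using p X0 by (simp add: field_simps)
  have "s * s \<le> s * 1" using s0 s1 by (intro mult_left_mono) auto
  then have "(s + s\<^sup>2) * X \<ge> (2 * s\<^sup>2) * X"
    using X0 by (intro mult_right_mono) (auto simp: power2_eq_square)
  also have "(2 * s\<^sup>2) * X = X + p / 2" using X0 by (simp add: sq field_simps)
  finally have "(s + s\<^sup>2) * X > p" using X0 by simp
  then have "(1 - s) * ((s + s\<^sup>2) * X - p) / s > 0" using s0 s1 by simp
  also have "(1 - s) * ((s + s\<^sup>2) * X - p) / s = p * (1 - 1 / s) + (1 - s\<^sup>2) * X"
    using s0 by (simp add: field_simps power2_eq_square)
  finally have "p * (1 - 1 / s) + (1 - s\<^sup>2) * X > 0" .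
  moreover have "1 - 1 / s \<le> ln s"
    using ln_le_minus_one[of "1 / s"] s0 by (simp add: ln_div)
  then have "p * (1 - 1 / s) \<le> p * ln s" using p by simp
  moreover have "1 + p * ln s \<le> s powr p"
    using s0 exp_ge_add_one_self[of "p * ln s"] by (simp add: powr_def)
  ultimately show ?thesis using s0 s1 by (intro that[of s]) auto
qed

section \<open>The extremal functions\<close>

text \<open>At n = qj these are the Taylor coefficients of (z^q - s)/(1 - s z^q), from (w - s)/(1 -
  sw) = -s + (1 - s^2) w/(1 - sw); for j \<ge> 1 the exponent \<open>n div q - 1\<close> is j -
  1.\<close>

definition moebius_coeff :: "nat \<Rightarrow> real \<Rightarrow> nat \<Rightarrow> complex" where
  "moebius_coeff q s n = (if n = 0 then - of_real s else of_real ((1 - s\<^sup>2) * s ^ (n div q - 1)))"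

lemma has_q_expansion_Moebius:
  assumes q: "q \<ge> 1" and s: "0 \<le> s" "s < 1"
  shows "has_q_expansion q (moebius_coeff q s) (\<lambda>z. Moebius_function 0 (of_real s) (z ^ q))"
  unfolding has_q_expansion_def
proof
  fix z :: complex assume "z \<in> ball 0 1"
  define w where "w = z ^ q"
  have "norm w < 1"
    using \<open>z \<in> ball 0 1\<close> q by (auto simp: w_def norm_power intro!: power_less_one_iff[THEN iffD2])
  then have "s * norm w < 1"
    using s mult_left_le_one_le[of "norm w" s] by simp
  then have sw: "norm (of_real s * w) < 1" using s by (simp add: norm_mult)
  then have ne: "1 - of_real s * w \<noteq> 0" by (metis eq_iff_diff_eq_0 less_irrefl norm_one)
  have "(\<lambda>j. of_real (1 - s\<^sup>2) * w * (of_real s * w) ^ j) sums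
      (of_real (1 - s\<^sup>2) * w * (1 / (1 - of_real s * w)))"
    by (intro sums_mult geometric_sums sw)
  moreover have "moebius_coeff q s (q * Suc j) * w ^ Suc j
      = of_real (1 - s\<^sup>2) * w * (of_real s * w) ^ j" for j
    using q by (simp add: moebius_coeff_def power_mult_distrib del: mult_Suc_right)
  ultimately have "(\<lambda>j. moebius_coeff q s (q * Suc j) * w ^ Suc j) sums
      (of_real (1 - s\<^sup>2) * w * (1 / (1 - of_real s * w)))" by (simp only:)
  then have "(\<lambda>j. moebius_coeff q s (q * j) * w ^ j) sums
      (of_real (1 - s\<^sup>2) * w * (1 / (1 - of_real s * w)) + moebius_coeff q s (q * 0) * w ^ 0)"
    by (rule sums_Suc)
  also have "of_real (1 - s\<^sup>2) * w * (1 / (1 - of_real s * w)) + moebius_coeff q s (q * 0) * w ^ 0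
      = Moebius_function 0 (of_real s) w"
    using ne by (simp add: Moebius_function_simple moebius_coeff_def field_simps power2_eq_square)
  finally show "(\<lambda>j. moebius_coeff q s (q * j) * z ^ (q * j)) sums
      Moebius_function 0 (of_real s) (z ^ q)"
    by (simp add: w_def power_mult)
qed

text \<open>Both series are geometric, and the refined Bohr inequality becomes an equality for this
  function.\<close>

lemma D_f_Moebius:
  assumes q: "q \<ge> 1" and s: "0 \<le> s" "s < 1" and w: "norm (\<omega> z) < 1"
  shows "D_f p q (moebius_coeff q s) (\<lambda>z. Moebius_function 0 (of_real s) (z ^ q)) \<omega> z
    = s powr p + (1 - s\<^sup>2) * (norm (\<omega> z) ^ q / (1 - norm (\<omega> z) ^ q))"
proof -
  define x where "x = norm (\<omega> z) ^ q"
  have x: "0 \<le> x" "x < 1"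
    using w q by (auto simp: x_def intro!: power_less_one_iff[THEN iffD2])
  have sq: "s\<^sup>2 \<le> 1" using s by (simp add: power_le_one)
  have sx: "s * x < 1" "s * x \<ge> 0" using s x mult_left_le_one_le[of x s] by auto
  then have sx2: "(s * x)\<^sup>2 < 1" by (simp add: power_less_one_iff)
  have c: "norm (moebius_coeff q s (q * Suc j)) = (1 - s\<^sup>2) * s ^ j" for j
    using q s sq by (simp add: moebius_coeff_def norm_mult norm_power del: of_real_diff of_real_power)
  have "(\<lambda>j. (1 - s\<^sup>2) * x * (s * x) ^ j) sums ((1 - s\<^sup>2) * x * (1 / (1 - s * x)))"
    using sx by (intro sums_mult geometric_sums) auto
  then have 1: "(\<Sum>j. norm (moebius_coeff q s (q * Suc j)) * norm (\<omega> z) ^ (q * Suc j))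
      = (1 - s\<^sup>2) * x / (1 - s * x)"
    unfolding c power_mult x_def[symmetric] by (simp add: sums_iff power_mult_distrib mult_ac)
  have "(\<lambda>j. ((1 - s\<^sup>2) * x)\<^sup>2 * ((s * x)\<^sup>2) ^ j) sums (((1 - s\<^sup>2) * x)\<^sup>2 * (1 / (1 - (s * x)\<^sup>2)))"
    using sx2 by (intro sums_mult geometric_sums) auto
  moreover have "((1 - s\<^sup>2) * x)\<^sup>2 * ((s * x)\<^sup>2) ^ j
      = (norm (moebius_coeff q s (q * Suc j)))\<^sup>2 * norm (\<omega> z) ^ (2 * q * Suc j)" for j
  proof -
    have "norm (\<omega> z) ^ (2 * q * Suc j) = (x ^ Suc j)\<^sup>2"
      by (simp add: x_def mult_ac del: mult_Suc_right power_Suc flip: power_mult)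
    then show ?thesis
      unfolding c by (simp add: power_mult_distrib power_mult[symmetric] mult_ac power_add)
  qed
  ultimately have 2: "(\<Sum>j. (norm (moebius_coeff q s (q * Suc j)))\<^sup>2 * norm (\<omega> z) ^ (2 * q * Suc j))
      = ((1 - s\<^sup>2) * x)\<^sup>2 / (1 - (s * x)\<^sup>2)"
    by (simp add: sums_iff)
  have f0: "norm (Moebius_function 0 (of_real s) (0 ^ q)) = s"
    using q s by (simp add: Moebius_function_of_zero power_0_left)
  \<comment> \<open>The numerator 1 + sx cancels one factor of 1 - (sx)^2.\<close>
  have "1 / (1 + s) + x / (1 - x) = (1 + s * x) / ((1 + s) * (1 - x))"
    using s x by (simp add: divide_simps) (simp add: algebra_simps)
  moreover have "((1 - s\<^sup>2) * x)\<^sup>2 / (1 - (s * x)\<^sup>2)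
      = (1 + s) * (1 - s) * (1 - s\<^sup>2) * x\<^sup>2 / ((1 + s * x) * (1 - s * x))"
    by (simp add: power2_eq_square algebra_simps)
  ultimately have "(1 / (1 + s) + x / (1 - x)) * (((1 - s\<^sup>2) * x)\<^sup>2 / (1 - (s * x)\<^sup>2))
      = (1 - s) * (1 - s\<^sup>2) * x\<^sup>2 / ((1 - x) * (1 - s * x))"
    using s x sx add_pos_nonneg[of 1 "s * x"] by simp
  \<comment> \<open>The factor 1 - sx cancels because (1 - x) + (1 - s)x = 1 - sx.\<close>
  moreover have "(1 - s\<^sup>2) * x / (1 - s * x) + (1 - s) * (1 - s\<^sup>2) * x\<^sup>2 / ((1 - x) * (1 - s * x))
      = (1 - s\<^sup>2) * (x / (1 - x))"
    using x sx by (simp add: divide_simps) (simp add: algebra_simps power2_eq_square)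
  ultimately show ?thesis
    unfolding D_f_def 1 2 f0 x_def[symmetric] by simp
qed

lemma deriv_power_self: "(deriv ^^ n) (\<lambda>z::complex. z ^ k) 0 = (if n = k then fact k else 0)"
proof -
  have "(deriv ^^ n) (\<lambda>z::complex. (z - 0) ^ k) 0 = pochhammer (of_nat (Suc k - n)) n * (0 - 0) ^ (k - n)"
    by (rule higher_deriv_power)
  \<comment> \<open>For \<open>n > k\<close> the truncated \<open>Suc k - n\<close> is 0 and the
    Pochhammer symbol vanishes; for \<open>n < k\<close> the power of 0 does.\<close>
  then show ?thesis
    by (cases n k rule: linorder_cases)
       (auto simp: pochhammer_0_left pochhammer_fact not_less)
qed

lemma power_mem_class_Bk: "(\<lambda>z. z ^ k) \<in> class_Bk k"
  by (auto simp: class_Bk_def class_B_def deriv_power_self norm_power power_le_one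
      intro!: holomorphic_intros)

lemma Moebius_power_mem_class_B:
  assumes "q \<ge> 1" "norm s < 1"
  shows "(\<lambda>z. Moebius_function 0 s (z ^ q)) \<in> class_B"
proof -
  have *: "norm (z ^ q) < 1" if "norm z < 1" for z :: complex
    using that assms by (auto simp: norm_power intro!: power_less_one_iff[THEN iffD2])
  have "Moebius_function 0 s \<circ> (\<lambda>z. z ^ q) holomorphic_on ball 0 1"
    by (rule holomorphic_on_compose_gen[OF _ Moebius_function_holomorphic])
       (use assms * in \<open>auto intro!: holomorphic_intros\<close>)
  then show ?thesis
    using * assms Moebius_function_norm_lt_1[of s] by (force simp: class_B_def o_def less_imp_le)
qed

section \<open>The sharp Bohr radius\<close>

text \<open>\<open>R5\<close> is the radius at which x = |z|^(qk) reaches m/(2+m), that is x/(1-x) =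
  m/2, the threshold of the real inequality.\<close>

lemma D_f_le_one:
  assumes k: "k \<ge> 1" and q: "q \<ge> 1" and p: "p > 0"
    and f: "f \<in> class_B" "norm (f 0) < 1" "has_q_expansion q a f"
    and \<omega>: "\<omega> \<in> class_Bk k" and z: "norm z \<le> R5 k p q"
  shows "D_f p q a f \<omega> z \<le> 1"
proof -
  define m where "m = min p 2"
  define x where "x = norm (\<omega> z) ^ q"
  define g where "g w = (\<Sum>j. a (q * j) * w ^ j)" for w
  have m: "m > 0" using p by (simp add: m_def)
  have z1: "norm z < 1" using z R5_bounds(2)[OF k q p] by simp
  have g: "(\<lambda>j. a (q * j) * w ^ j) sums g w \<and> norm (g w) \<le> 1" if w: "norm w < 1" for w
  proof -
    \<comment> \<open>A q-th root of \<open>w\<close> in the disk: convergence and the bound for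
      \<open>g\<close> at \<open>w\<close> are those of \<open>f\<close> at
      \<open>\<zeta>\<close>.\<close>
    define \<zeta> where "\<zeta> = (if w = 0 then 0 else exp (Ln w / of_nat q))"
    have \<zeta>: "\<zeta> ^ q = w"
      using q by (auto simp: \<zeta>_def exp_of_nat_mult[symmetric])
    then have "norm \<zeta> ^ q < 1" using w by (simp flip: norm_power)
    then have \<zeta>1: "norm \<zeta> < 1" using q by (subst (asm) power_less_one_iff) auto
    then have "(\<lambda>j. a (q * j) * w ^ j) sums f \<zeta>"
      using f(3) \<zeta> by (force simp: has_q_expansion_def power_mult)
    moreover have "norm (f \<zeta>) \<le> 1" using f(1) \<zeta>1 by (simp add: class_B_def)
    ultimately show ?thesis by (simp add: g_def sums_iff)
  qed
  have f0: "f 0 = a (q * 0)"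
  proof -
    have "(\<lambda>j. a (q * j) * (0 ^ q) ^ j) sums f 0"
      using f(3) by (auto simp: has_q_expansion_def power_mult)
    then have "(\<lambda>j. a (q * j) * 0 ^ j) sums f 0" using q by (simp add: power_0_left)
    then show ?thesis by (simp only: powser_sums_zero_iff)
  qed
  have "norm (\<omega> z) \<le> norm z ^ k"
    using \<omega> z1 by (intro schwarz_higher_order) (auto simp: class_Bk_def class_B_def)
  then have "x \<le> (norm z ^ k) ^ q"
    unfolding x_def by (intro power_mono) auto
  also have "\<dots> \<le> R5 k p q ^ (q * k)"
    using z by (simp add: power_mult[symmetric] mult.commute power_mono)
  also have "\<dots> = m / (2 + m)"
    unfolding R5_def m_def[symmetric] using k q m by (intro real_root_pow_pos2) auto
  finally have xm: "x \<le> m / (2 + m)" .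
  also have "m / (2 + m) < 1" using m by simp
  finally have x1: "x < 1" .
  have x0: "x \<ge> 0" by (simp add: x_def)
  from xm have Y: "x / (1 - x) \<le> m / 2" using x1 m by (simp add: field_simps)
  have pw: "norm (\<omega> z) ^ (q * Suc j) = x ^ Suc j" "norm (\<omega> z) ^ (2 * q * Suc j) = x ^ (2 * Suc j)" for j
    unfolding x_def power_mult[symmetric] by (simp_all only: mult_ac)
  have "D_f p q a f \<omega> z \<le> norm (f 0) powr p + (1 - (norm (f 0))\<^sup>2) * (x / (1 - x))"
    unfolding D_f_def pw x_def[symmetric] f0 add.assoc
    by (intro add_left_mono refined_bohr_inequality[where b = "\<lambda>j. a (q * j)" and g = g])
       (use g x0 x1 in auto)
  also have "\<dots> \<le> 1"
    by (rule powr_add_mult_le_one) (use f(2) p Y in \<open>auto simp: m_def\<close>)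
  finally show ?thesis .
qed

text \<open>At z = R with \<omega>(z) = z^k, Schwarz's lemma is an equality and x = R^(qk) exceeds
  the threshold, so a suitable Moebius parameter \<open>s\<close> exists.\<close>

lemma D_f_gt_one:
  assumes k: "k \<ge> 1" and q: "q \<ge> 1" and p: "p > 0"
    and R: "R5 k p q < R" "R < 1"
  obtains f a \<omega> z where "f \<in> class_B" "norm (f 0) < 1" "has_q_expansion q a f"
    "\<omega> \<in> class_Bk k" "norm z \<le> R" "D_f p q a f \<omega> z > 1"
proof -
  define m where "m = min p 2"
  define x where "x = norm (complex_of_real R ^ k) ^ q"
  have m: "m > 0" using p by (simp add: m_def)
  have R0: "R > 0" using R(1) R5_bounds(1)[OF k q p] by simp
  have nR: "norm (complex_of_real R ^ k) < 1"
    using R0 R(2) k by (auto simp: norm_power intro!: power_less_one_iff[THEN iffD2])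
  have "m / (2 + m) = R5 k p q ^ (q * k)"
    unfolding R5_def m_def[symmetric] using k q m by (intro real_root_pow_pos2[symmetric]) auto
  also have "\<dots> < R ^ (q * k)"
    using R(1) R5_bounds(1)[OF k q p] k q by (intro power_strict_mono) auto
  also have "R ^ (q * k) = x"
    using R0 by (simp add: x_def norm_power mult.commute flip: power_mult)
  finally have xm: "m / (2 + m) < x" .
  have "x < 1"
    using nR q unfolding x_def by (subst power_less_one_iff) auto
  with xm m have "x / (1 - x) > m / 2" by (simp add: field_simps)
  then obtain s where s: "0 \<le> s" "s < 1" "s powr p + (1 - s\<^sup>2) * (x / (1 - x)) > 1"
    using powr_add_mult_gt_one[OF p, of "x / (1 - x)"] by (auto simp: m_def)
  show thesis
  proof (rule that)
    show "(\<lambda>z. Moebius_function 0 (of_real s) (z ^ q)) \<in> class_B"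
      using q s by (intro Moebius_power_mem_class_B) auto
    show "norm (Moebius_function 0 (of_real s) (0 ^ q)) < 1"
      using q s by (simp add: Moebius_function_of_zero power_0_left)
    show "has_q_expansion q (moebius_coeff q s) (\<lambda>z. Moebius_function 0 (of_real s) (z ^ q))"
      using q s(1,2) by (rule has_q_expansion_Moebius)
    show "(\<lambda>z. z ^ k) \<in> class_Bk k" by (rule power_mem_class_Bk)
    show "norm (complex_of_real R) \<le> R" using R0 by simp
    show "D_f p q (moebius_coeff q s) (\<lambda>z. Moebius_function 0 (of_real s) (z ^ q)) (\<lambda>z. z ^ k)
        (complex_of_real R) > 1"
      using s(3) by (subst D_f_Moebius[OF q s(1,2), of "\<lambda>z. z ^ k"]) (use nR in \<open>simp_all add: x_def\<close>)
  qed
qed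

theorem theorem5:
  fixes k q :: nat and p :: real
  assumes "k \<ge> 1" and "q \<ge> 1" and "p > 0"
  shows "(\<forall>f a \<omega> z. f \<in> class_B \<longrightarrow> norm (f 0) < 1 \<longrightarrow> has_q_expansion q a f \<longrightarrow>
            \<omega> \<in> class_Bk k \<longrightarrow> norm z \<le> R5 k p q \<longrightarrow> D_f p q a f \<omega> z \<le> 1)
       \<and> (\<forall>R. R5 k p q < R \<and> R < 1 \<longrightarrow>
            (\<exists>f a \<omega> z. f \<in> class_B \<and> norm (f 0) < 1 \<and> has_q_expansion q a f \<and>
               \<omega> \<in> class_Bk k \<and> norm z \<le> R \<and> D_f p q a f \<omega> z > 1))"
  using D_f_le_one[OF assms] D_f_gt_one[OF assms] by (intro conjI allI impI) metis+

end
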